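(* Let $N$ be a squarefree positive integer and let $\{f_j\}_{j\ge 1}$ be the normalised Hecke eigenbasis of Maass newforms of level $N$ with trivial character, with Laplace eigenvalues $0<\lambda_1\le\lambda_2\le\cdots$ and Hecke eigenvalues $a_j(n)$. Let $H$ be a non-negative, sufficiently nice test function (see context), put $\widetilde{H}(\lambda)=\lambda H(\lambda)$, let $M\ge 1$, and let $Q$ and $\widetilde{Q}$ be the symmetric matrices of the quadratic forms $c\mapsto Q(c,H)$ and $c\mapsto Q(c,\widetilde{H})$ on real sequences $c=\{c(m)\}_{m=1}^M$ with $c(m)=0$ whenever $\gcd(m,N)>1$; here $Q=PDP^T$ with $P$ orthogonal and $D$ diagonal with positive entries. Let $\widetilde{\lambda}_i$ be an eigenvalue of the generalised symmetric eigenvalue problem $\widetilde{Q}x=\lambda Qx$ (equivalently, of $D^{-1/2}P^T\widetilde{Q}PD^{-1/2}$), serving as the approximation to $\lambda_i$, and let $c_i=\{c_i(m)\}_{m=1}^M$ be the sequence formed from the components of the corresponding eigenvector. Put $\widetilde{H}_i(\lambda)=H(\lambda)(\lambda-\widetilde{\lambda}_i)^2$ and $$\varepsilon_i=\sqrt{\frac{Q(c_i,\widetilde{H}_i)}{Q(c_i,H)}},$$ and suppose $\delta_i>0$ is such that $$|\lambda_i-\widetilde{\lambda}_i|\le\varepsilon_i\quad\text{and}\quad|\lambda_j-\widetilde{\lambda}_i|\ge\delta_i\ \text{ for all } j\in\mathbb{N}\setminus\{i\}.$$ Define $W_i=L_i(c_i)H(\lambda_i)$, where $L_j(c)=\sum_{m=1}^M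 c(m)a_j(m)$, and $$\eta_{i,n}=\frac{\varepsilon_i}{\delta_i}\sqrt{Q(c_i,H)\,Q(e_n,H)}.$$ Then for every positive integer $n$ with $\gcd(n,N)=1$, $$a_i(n)W_i=\sum_{m=1}^M c_i(m)\sum_{d\mid\gcd(m,n)}t\Big(\frac{mn}{d^2},H\Big)+\beta_{i,n}\,\eta_{i,n},$$ where $\beta_{i,n}$ is a real constant depending on $i$ and $n$ with $|\beta_{i,n}|\le 1$. (Since $a_i(1)=1$, the case $n=1$ gives $W_i$ to a proven accuracy, and so the formula can be used to compute $a_i(n)$ for $\gcd(n,N)=1$.)
   Context: A Maass cusp form (weight $0$) for $\Gamma_0(N)$ is a non-constant smooth $\Gamma_0(N)$-invariant function on the upper half-plane $\mathbb{H}$ that lies in $L^2(\Gamma_0(N)\backslash\mathbb{H})$, vanishes at the cusps, and is an eigenfunction of $\Delta=-y^2(\partial_x^2+\partial_y^2)$. Newforms are those in the orthogonal complement (for the Petersson inner product) of the span of the oldforms $f(kz)$, with $f$ a form for $\Gamma_0(K)$, $K\mid N$, $K<N$, $k\mid N/K$. The sequence $\{f_j\}_{j\ge1}$ is a basis, consisting of Hecke eigenforms normalised by $a_j(1)=1$, of the direct sum over $\lambda>0$ of the spaces of Maass newforms of level $N$, trivial character and Laplace eigenvalue $\lambda$; $\lambda_j$ is the Laplace eigenvalue of $f_j$, and $a_j(n)$ is defined by $T_nf_j=a_j(n)f_j$, where for $n>0$ $$T_nf(z)=\frac{1}{\sqrt{n}}\sum_{\substack{ad=n,\ d>0\\ \gcd(a,N)=1}}\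 \sum_{b=0}^{d-1}f\Big(\frac{az+b}{d}\Big).$$ These satisfy the Hecke relations $a_j(m)a_j(n)=\sum_{d\mid\gcd(m,n)}a_j(mn/d^2)$ for $m,n\ge 1$ coprime to $N$. For a test function $H$ of $\lambda$, a positive integer $n$ coprime to $N$, and a real sequence $c=\{c(m)\}_{m=1}^M$ with $c(m)=0$ whenever $\gcd(m,N)>1$, $$t(n,H)=\sum_{j=1}^\infty a_j(n)H(\lambda_j),\qquad Q(c,H)=\sum_{j=1}^\infty\Big(\sum_{m=1}^{M}c(m)a_j(m)\Big)^2H(\lambda_j),$$ and by the Hecke relations $Q(c,H)=\sum_{m_1,m_2=1}^{M}c(m_1)c(m_2)\sum_{d\mid\gcd(m_1,m_2)}t(m_1m_2/d^2,H)$. The sequence $e_n$ is $e_n(m)=1$ if $m=n$ and $0$ otherwise, so $Q(e_n,H)=\sum_j a_j(n)^2H(\lambda_j)$. "Sufficiently nice" means that the Selberg trace formula can be applied to the test functions involved ($H$, $\widetilde{H}$, $\widetilde{H}_i$). Its hypotheses, for a test function $F$ of $\lambda=\frac14+r^2$ written as $h(r)=F(\frac14+r^2)$, are: for some $\delta>0$, $h$ is even and analytic on the strip $|\mathrm{Im}(r)|\le\frac12+\delta$, $h(r)\in\mathbb{R}$ for $r\in\mathbb{R}$, and $h(r)=O((1+|r|^2)^{-1-\delta})$. *)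

theory Defs
  imports
    "HOL-Analysis.Analysis"
    "HOL-Computational_Algebra.Squarefree"
    "HOL-Library.Function_Algebras"
begin

section \<open>Maass cusp forms for \<open>\<Gamma>\<^sub>0(N)\<close>\<close>

definition upper_half_plane :: "complex set" where
  "upper_half_plane = {z. Im z > 0}"

definition moebius_act :: "int \<Rightarrow> int \<Rightarrow> int \<Rightarrow> int \<Rightarrow> complex \<Rightarrow> complex" where
  "moebius_act a b c d z = (of_int a * z + of_int b) / (of_int c * z + of_int d)"

definition Gamma0_invariant :: "nat \<Rightarrow> (complex \<Rightarrow> complex) \<Rightarrow> bool" where
  "Gamma0_invariant N f \<longleftrightarrow>
     (\<forall>a b c d. a * d - b * c = 1 \<and> int N dvd c \<longrightarrow>
        (\<forall>z\<in>upper_half_plane. f (moebius_act a b c d z) = f z))"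

definition partial_x :: "(complex \<Rightarrow> complex) \<Rightarrow> complex \<Rightarrow> complex" where
  "partial_x f z = vector_derivative (\<lambda>t. f (z + of_real t)) (at 0)"

definition partial_y :: "(complex \<Rightarrow> complex) \<Rightarrow> complex \<Rightarrow> complex" where
  "partial_y f z = vector_derivative (\<lambda>t. f (z + \<i> * of_real t)) (at 0)"

fun C_k_on :: "nat \<Rightarrow> complex set \<Rightarrow> (complex \<Rightarrow> complex) \<Rightarrow> bool" where
  "C_k_on 0 S f \<longleftrightarrow> continuous_on S f"
| "C_k_on (Suc k) S f \<longleftrightarrow>
     continuous_on S f \<and>
     (\<forall>z\<in>S. (\<lambda>t::real. f (z + of_real t)) differentiable at 0 \<and>
            (\<lambda>t::real. f (z + \<i> * of_real t)) differentiable at 0) \<and>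
     C_k_on k S (partial_x f) \<and> C_k_on k S (partial_y f)"

definition hyp_laplacian :: "(complex \<Rightarrow> complex) \<Rightarrow> complex \<Rightarrow> complex" where
  "hyp_laplacian f z =
     - (of_real (Im z))\<^sup>2 * (partial_x (partial_x f) z + partial_y (partial_y f) z)"

text \<open>The Ford fundamental domain of \<open>\<Gamma>\<^sub>0(N)\<close>: since \<open>Im (\<gamma>z) = Im z / |cz + d|\<^sup>2\<close>, it consists of
  the points of maximal height in their orbit, modulo the stabiliser of \<open>\<infinity>\<close>, which acts by
  integer translations. Its boundary has measure zero.\<close>

definition Gamma0_domain :: "nat \<Rightarrow> complex set" where
  "Gamma0_domain N =
     {z \<in> upper_half_plane. \<bar>Re z\<bar> \<le> 1 / 2 \<and>
        (\<forall>c d :: int. int N dvd c \<and> coprime c d \<longrightarrow> 1 \<le> cmod (of_int c * z + of_int d))}"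

definition square_integrable :: "nat \<Rightarrow> (complex \<Rightarrow> complex) \<Rightarrow> bool" where
  "square_integrable N f \<longleftrightarrow>
     set_integrable lborel (Gamma0_domain N) (\<lambda>z. (cmod (f z))\<^sup>2 / (Im z)\<^sup>2)"

definition petersson :: "nat \<Rightarrow> (complex \<Rightarrow> complex) \<Rightarrow> (complex \<Rightarrow> complex) \<Rightarrow> complex" where
  "petersson N f g =
     set_lebesgue_integral lborel (Gamma0_domain N) (\<lambda>z. f z * cnj (g z) / of_real ((Im z)\<^sup>2))"

text \<open>Every cusp is \<open>\<gamma>\<infinity>\<close> for some \<open>\<gamma> \<in> SL\<^sub>2(\<int>)\<close>.\<close>

definition vanishes_at_cusps :: "(complex \<Rightarrow> complex) \<Rightarrow> bool" where
  "vanishes_at_cusps f \<longleftrightarrow>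
     (\<forall>a b c d. a * d - b * c = 1 \<longrightarrow>
        ((\<lambda>z. f (moebius_act a b c d z)) \<longlongrightarrow> 0) (filtercomap Im at_top))"

text \<open>A function on the upper half-plane is extended by zero to all of \<open>\<complex>\<close>, so that equality of
  functions is equality on the upper half-plane.\<close>

definition maass_cusp_form :: "nat \<Rightarrow> real \<Rightarrow> (complex \<Rightarrow> complex) \<Rightarrow> bool" where
  "maass_cusp_form N ev f \<longleftrightarrow>
     (\<forall>z. z \<notin> upper_half_plane \<longrightarrow> f z = 0) \<and>
     \<not> f constant_on upper_half_plane \<and>
     (\<forall>k. C_k_on k upper_half_plane f) \<and>
     Gamma0_invariant N f \<and>
     square_integrable N f \<and>
     vanishes_at_cusps f \<and>
     (\<forall>z\<in>upper_half_plane. hyp_laplacian f z = of_real ev * f z)"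

section \<open>Newforms and the Hecke eigenbasis\<close>

definition fun_scale :: "complex \<Rightarrow> (complex \<Rightarrow> complex) \<Rightarrow> complex \<Rightarrow> complex" where
  "fun_scale c f = (\<lambda>z. c * f z)"

lemma vector_space_fun_scale: "vector_space fun_scale"
  by unfold_locales (auto simp: fun_scale_def fun_eq_iff algebra_simps)

definition oldforms :: "nat \<Rightarrow> (complex \<Rightarrow> complex) set" where
  "oldforms N =
     {(\<lambda>z. f (of_nat k * z)) | f ev K k.
        K dvd N \<and> K < N \<and> k dvd N div K \<and> maass_cusp_form K ev f}"

definition newform_space :: "nat \<Rightarrow> real \<Rightarrow> (complex \<Rightarrow> complex) set" where
  "newform_space N ev =
     {f. (f = 0 \<or> maass_cusp_form N ev f) \<and>
         (\<forall>g\<in>module.span fun_scale (oldforms N). petersson N f g = 0)}"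

definition hecke :: "nat \<Rightarrow> nat \<Rightarrow> (complex \<Rightarrow> complex) \<Rightarrow> complex \<Rightarrow> complex" where
  "hecke N n f z =
     1 / of_real (sqrt (real n)) *
       (\<Sum>(a, d) | a * d = n \<and> 0 < d \<and> coprime a N.
          \<Sum>b<d. f ((of_nat a * z + of_nat b) / of_nat d))"

text \<open>The sequence is indexed from 0: \<open>f 0\<close> is the first basis element. Eigenfunctions with
  distinct eigenvalues being linearly independent, the direct sum of the newform spaces is
  the span of their union.\<close>

definition newform_eigenbasis ::
    "nat \<Rightarrow> (nat \<Rightarrow> complex \<Rightarrow> complex) \<Rightarrow> (nat \<Rightarrow> real) \<Rightarrow> (nat \<Rightarrow> nat \<Rightarrow> real) \<Rightarrow> bool" where
  "newform_eigenbasis N f ev a \<longleftrightarrow>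
     (\<forall>j. 0 < ev j \<and> maass_cusp_form N (ev j) (f j) \<and> f j \<in> newform_space N (ev j)) \<and>
     inj f \<and>
     \<not> module.dependent fun_scale (range f) \<and>
     module.span fun_scale (range f) =
       module.span fun_scale (\<Union>l\<in>{0<..}. newform_space N l) \<and>
     (\<forall>j. \<forall>n>0. hecke N n (f j) = fun_scale (of_real (a j n)) (f j)) \<and>
     (\<forall>j. a j 1 = 1)"

section \<open>Test functions and quadratic forms\<close>

text \<open>The hypotheses of the Selberg trace formula. Here \<open>h\<close> is the function \<open>h(r) = F(1/4 + r\<^sup>2)\<close>, which
  \<open>F\<close> prescribes where \<open>1/4 + r\<^sup>2\<close> is real: on the real axis and, for eigenvalues below \<open>1/4\<close>,
  on the imaginary segment of the strip.\<close>

definition selberg_test_function :: "(real \<Rightarrow> real) \<Rightarrow> bool" where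
  "selberg_test_function F \<longleftrightarrow>
     (\<exists>\<delta>>0. \<exists>h :: complex \<Rightarrow> complex. let S = {r. \<bar>Im r\<bar> \<le> 1 / 2 + \<delta>} in
        h analytic_on S \<and>
        (\<forall>r\<in>S. h (- r) = h r) \<and>
        (\<forall>r\<in>S. \<forall>x::real. 1 / 4 + r\<^sup>2 = of_real x \<longrightarrow> h r = of_real (F x)) \<and>
        (\<exists>B. \<forall>r\<in>S. cmod (h r) \<le> B * (1 + (cmod r)\<^sup>2) powr (- 1 - \<delta>)))"

definition lin_form :: "(nat \<Rightarrow> nat \<Rightarrow> real) \<Rightarrow> nat \<Rightarrow> (nat \<Rightarrow> real) \<Rightarrow> nat \<Rightarrow> real" where
  "lin_form a M c j = (\<Sum>m=1..M. c m * a j m)"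

definition quad_form ::
    "(nat \<Rightarrow> nat \<Rightarrow> real) \<Rightarrow> (nat \<Rightarrow> real) \<Rightarrow> nat \<Rightarrow> (nat \<Rightarrow> real) \<Rightarrow> (real \<Rightarrow> real) \<Rightarrow> real" where
  "quad_form a ev M c F = (\<Sum>j. (lin_form a M c j)\<^sup>2 * F (ev j))"

definition unit_seq :: "nat \<Rightarrow> nat \<Rightarrow> real" where
  "unit_seq n m = (if m = n then 1 else 0)"

text \<open>Matrices indexed by a finite set \<open>I\<close> of positive integers.\<close>

definition quad_form_matrix ::
    "nat set \<Rightarrow> ((nat \<Rightarrow> real) \<Rightarrow> real) \<Rightarrow> (nat \<Rightarrow> nat \<Rightarrow> real) \<Rightarrow> bool" where
  "quad_form_matrix I q A \<longleftrightarrow>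
     (\<forall>m\<in>I. \<forall>m'\<in>I. A m m' = A m' m) \<and>
     (\<forall>c. (\<forall>m. m \<notin> I \<longrightarrow> c m = 0) \<longrightarrow> q c = (\<Sum>m\<in>I. \<Sum>m'\<in>I. c m * A m m' * c m'))"

definition orthogonal_on :: "nat set \<Rightarrow> (nat \<Rightarrow> nat \<Rightarrow> real) \<Rightarrow> bool" where
  "orthogonal_on I P \<longleftrightarrow>
     (\<forall>m\<in>I. \<forall>m'\<in>I. (\<Sum>k\<in>I. P k m * P k m') = (if m = m' then 1 else 0) \<and>
                   (\<Sum>k\<in>I. P m k * P m' k) = (if m = m' then 1 else 0))"

end

theory Submission
  imports Defs "HOL-Number_Theory.Cong"
begin

text \<open>Hecke multiplicativity and the trace values \<open>t(n, H)\<close> evaluate the spectral sum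
  \<open>\<Sum>\<^sub>j a\<^sub>j(n) L\<^sub>j(c) H(\<lambda>\<^sub>j)\<close> as the double sum \<open>\<Sum>\<^sub>m c(m) \<Sum>\<^sub>d t(mn/d\<^sup>2, H)\<close>
  (\<open>spectral_sum_lin_form\<close>). Its \<open>i\<close>-th term is \<open>a\<^sub>i(n) W\<close>, so the error is the sum of the other
  terms. By Cauchy--Schwarz (\<open>suminf_Cauchy_Schwarz\<close>) that sum is in absolute value at most
  \<open>\<surd>(\<Sum>\<^sub>j\<^sub>\<noteq>\<^sub>i L\<^sub>j(c)\<^sup>2 H(\<lambda>\<^sub>j)) \<surd>Q(e\<^sub>n, H)\<close>. For \<open>j \<noteq> i\<close> the eigenvalue
  \<open>\<lambda>\<^sub>j\<close> is at distance at least \<open>\<delta>\<close> from the approximation, so each summand under the first root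
  is at most \<open>\<delta>\<^sup>-\<^sup>2\<close> times the corresponding summand of \<open>Q(c, Hi) = \<epsilon>\<^sup>2 Q(c, H)\<close>. The bound is
  therefore \<open>\<eta> n\<close>.

  The Hecke relations for the eigenvalues follow from a composition law for the operators
  (\<open>hecke_sum_compose\<close>). For \<open>n\<close> coprime to the level, \<open>\<surd>n T\<^sub>n\<close> is the sum of \<open>V\<^sub>x U\<^sub>y\<close> over
  \<open>xy = n\<close>, where \<open>V\<^sub>x\<close> dilates by \<open>x\<close> and \<open>U\<^sub>y\<close> sums over the \<open>y\<close> points \<open>(z + b) / y\<close>, \<open>b < y\<close>.
  On functions of period 1 one has \<open>U\<^sub>d V\<^sub>x = e V\<^sub>x\<^sub>/\<^sub>e U\<^sub>d\<^sub>/\<^sub>e\<close> with \<open>e = gcd d x\<close>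
  (\<open>avg_of_dilation\<close>), together with \<open>U\<^sub>d U\<^sub>y = U\<^sub>d\<^sub>y\<close>. The composition law is then a
  rearrangement of factorisations (\<open>sum_factor_pairs_reindex\<close>). All the matrices
  being upper triangular, this is an identity about functions of period 1.\<close>

section \<open>Sums of periodic functions over residues\<close>

lemma periodic_mod:
  fixes F :: "nat \<Rightarrow> complex"
  assumes "\<And>b. F (b + d) = F b"
  shows "F b = F (b mod d)"
proof -
  have "F (r + k * d) = F r" for r k
  proof (induction k)
    case (Suc k)
    have "F (r + Suc k * d) = F ((r + k * d) + d)" by (simp add: algebra_simps)
    with Suc assms show ?case by simp
  qed simp
  from this[of "b mod d" "b div d"] show ?thesis by (simp add: mult.commute)
qed

lemma periodic_sum_mult:
  fixes F :: "nat \<Rightarrow> complex"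
  assumes "\<And>b. F (b + d) = F b"
  shows "(\<Sum>b<e * d. F b) = of_nat e * (\<Sum>b<d. F b)"
proof -
  have "(\<Sum>b<e * d. F b) = (\<Sum>k<e. \<Sum>b\<in>{k * d..<k * d + d}. F b)"
    by (simp add: sum.nat_group)
  also have "\<dots> = (\<Sum>k<e. \<Sum>b<d. F b)"
  proof (rule sum.cong[OF refl])
    fix k
    have "(\<Sum>b\<in>{k * d..<k * d + d}. F b) = (\<Sum>b<d. F (b + k * d))"
      using sum.shift_bounds_nat_ivl[of F 0 "k * d" d] by (simp add: lessThan_atLeast0 add.commute)
    also have "\<dots> = (\<Sum>b<d. F b)"
    proof (rule sum.cong[OF refl])
      fix b
      show "F (b + k * d) = F b"
        using periodic_mod[of F d, OF assms, of "b + k * d"] periodic_mod[of F d, OF assms, of b]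
        by simp
    qed
    finally show "(\<Sum>b\<in>{k * d..<k * d + d}. F b) = (\<Sum>b<d. F b)" .
  qed
  also have "\<dots> = of_nat e * (\<Sum>b<d. F b)" by simp
  finally show ?thesis .
qed

lemma periodic_sum_unit:
  fixes F :: "nat \<Rightarrow> complex"
  assumes per: "\<And>b. F (b + d) = F b" and cop: "coprime a d" and "0 < d"
  shows "(\<Sum>b<d. F (a * b)) = (\<Sum>b<d. F b)"
proof -
  have inj: "inj_on (\<lambda>b. a * b mod d) {..<d}"
  proof (rule inj_onI)
    fix x y assume xy: "x \<in> {..<d}" "y \<in> {..<d}" and eq: "a * x mod d = a * y mod d"
    have "[x = y] (mod d)"
      using eq cong_mult_lcancel_nat[OF cop] by (simp add: cong_def)
    with xy show "x = y" by (simp add: cong_def)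
  qed
  have "(\<lambda>b. a * b mod d) ` {..<d} = {..<d}"
    using \<open>0 < d\<close> by (intro endo_inj_surj inj) auto
  with inj have bij: "bij_betw (\<lambda>b. a * b mod d) {..<d} {..<d}" by (simp add: bij_betw_def)
  have "(\<Sum>b<d. F (a * b)) = (\<Sum>b<d. F (a * b mod d))"
    by (intro sum.cong refl periodic_mod per)
  also have "\<dots> = (\<Sum>b<d. F b)" by (rule sum.reindex_bij_betw[OF bij])
  finally show ?thesis .
qed

section \<open>Composition of Hecke operators\<close>

text \<open>With \<open>V\<^sub>x g(z) = g(xz)\<close> and \<open>U\<^sub>y g(z) = (\<Sum>b<y. g((z + b) / y))\<close>, this is \<open>V\<^sub>x (U\<^sub>y g)\<close>. In
  particular \<open>x = 1\<close> gives \<open>U\<^sub>y\<close>.\<close>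

definition dilated_avg :: "nat \<Rightarrow> nat \<Rightarrow> (complex \<Rightarrow> complex) \<Rightarrow> complex \<Rightarrow> complex" where
  "dilated_avg x y g z = (\<Sum>b<y. g ((of_nat x * z + of_nat b) / of_nat y))"

definition factor_pairs :: "nat \<Rightarrow> (nat \<times> nat) set" where
  "factor_pairs n = {(a, d). a * d = n}"

text \<open>This is \<open>\<surd>n T\<^sub>n\<close> for \<open>n\<close> coprime to the level. Without the factor \<open>1 / \<surd>n\<close> the composition
  law has integral coefficients.\<close>

definition hecke_sum :: "nat \<Rightarrow> (complex \<Rightarrow> complex) \<Rightarrow> complex \<Rightarrow> complex" where
  "hecke_sum n g z = (\<Sum>(a, d)\<in>factor_pairs n. dilated_avg a d g z)"

lemma dilated_avg_periodic:
  assumes per: "\<And>w. g (w + 1) = g w" and "0 < y"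
  shows "dilated_avg 1 y g (w + 1) = dilated_avg 1 y g w"
proof -
  define F where "F b = g ((w + of_nat b) / of_nat y)" for b
  have "F y = F 0"
    using per[of "w / of_nat y"] \<open>0 < y\<close> by (simp add: F_def add_divide_distrib)
  have "dilated_avg 1 y g (w + 1) = (\<Sum>b<y. F (Suc b))"
    by (simp add: dilated_avg_def F_def algebra_simps)
  also have "\<dots> = (\<Sum>b<Suc y. F b) - F 0" by (simp add: sum.lessThan_Suc_shift del: sum.lessThan_Suc)
  also have "\<dots> = (\<Sum>b<y. F b)" using \<open>F y = F 0\<close> by simp
  finally show ?thesis by (simp add: dilated_avg_def F_def)
qed

text \<open>This is \<open>U\<^sub>d V\<^sub>x = e V\<^sub>x\<^sub>/\<^sub>e U\<^sub>d\<^sub>/\<^sub>e\<close>, \<open>e = gcd d x\<close>. After cancelling \<open>e\<close> from \<open>x / d\<close>, the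
  summand depends only on \<open>b\<close> modulo \<open>d / e\<close>, so every residue class occurs \<open>e\<close> times; multiplication
  by the unit \<open>x / e\<close> permutes the classes.\<close>

lemma avg_of_dilation:
  assumes per: "\<And>w. g (w + 1) = g w" and "0 < d"
  shows "(\<Sum>b<d. g (of_nat x * ((z + of_nat b) / of_nat d))) =
    of_nat (gcd d x) * dilated_avg (x div gcd d x) (d div gcd d x) g z"
proof -
  define e where "e = gcd d x"
  define d' where "d' = d div e"
  define x' where "x' = x div e"
  have e: "0 < e" and d: "d = e * d'" and x: "x = e * x'"
    using \<open>0 < d\<close> by (auto simp: e_def d'_def x'_def)
  have cop: "coprime x' d'"
    using \<open>0 < d\<close> unfolding x'_def d'_def e_def
    by (metis coprime_commute div_gcd_coprime less_numeral_extra(3))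
  have d'0: "0 < d'" using d \<open>0 < d\<close> by simp
  define F where "F b = g ((of_nat x' * z + of_nat b) / of_nat d')" for b :: nat
  have F: "F (b + d') = F b" for b
    using per[of "(of_nat x' * z + of_nat b) / of_nat d'"] d'0
    by (simp add: F_def add_divide_distrib add.assoc)
  have "g (of_nat x * ((z + of_nat b) / of_nat d)) = F (x' * b)" for b
  proof -
    have "of_nat x * ((z + of_nat b) / of_nat d) = (of_nat x' * z + of_nat (x' * b)) / of_nat d'"
      using e d'0 by (simp add: d x divide_simps) (simp add: algebra_simps)
    then show ?thesis by (simp only: F_def)
  qed
  then have "(\<Sum>b<d. g (of_nat x * ((z + of_nat b) / of_nat d))) = (\<Sum>b<e * d'. F (x' * b))"
    by (simp add: d)
  also have "\<dots> = of_nat e * (\<Sum>b<d'. F (x' * b))"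
  proof (rule periodic_sum_mult)
    fix b
    have "F (x' * (b + d')) = F (x' * (b + d') mod d')" by (rule periodic_mod) (rule F)
    also have "\<dots> = F (x' * b mod d')" by (simp add: distrib_left)
    also have "\<dots> = F (x' * b)" by (rule periodic_mod[symmetric]) (rule F)
    finally show "F (x' * (b + d')) = F (x' * b)" .
  qed
  also have "(\<Sum>b<d'. F (x' * b)) = (\<Sum>b<d'. F b)"
    by (rule periodic_sum_unit) (use F cop d'0 in auto)
  finally show ?thesis by (simp add: dilated_avg_def F_def e_def d'_def x'_def)
qed

text \<open>The relation \<open>U\<^sub>d U\<^sub>y = U\<^sub>d\<^sub>y\<close>: the shifts \<open>b + k d\<close> with \<open>b < d\<close> and \<open>k < y\<close> run once through
  the numbers below \<open>d y\<close>.\<close>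

lemma dilated_avg_avg:
  assumes "0 < d"
  shows "dilated_avg x d (dilated_avg 1 y g) z = dilated_avg x (d * y) g z"
proof -
  define F where "F b = g ((of_nat x * z + of_nat b) / of_nat (d * y))" for b :: nat
  have "dilated_avg x d (dilated_avg 1 y g) z = (\<Sum>b<d. \<Sum>k<y. F (b + k * d))"
    unfolding dilated_avg_def F_def
  proof (intro sum.cong refl arg_cong[of _ _ g])
    fix b k assume "k \<in> {..<y}"
    then show "(of_nat 1 * ((of_nat x * z + of_nat b) / of_nat d) + of_nat k) / of_nat y
      = (of_nat x * z + of_nat (b + k * d)) / of_nat (d * y)"
      using \<open>0 < d\<close> by (simp add: field_simps)
  qed
  also have "\<dots> = (\<Sum>k<y. \<Sum>b<d. F (b + k * d))" by (rule sum.swap)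
  also have "\<dots> = (\<Sum>k<y. \<Sum>b\<in>{k * d..<k * d + d}. F b)"
  proof (rule sum.cong[OF refl])
    fix k
    show "(\<Sum>b<d. F (b + k * d)) = (\<Sum>b\<in>{k * d..<k * d + d}. F b)"
      using sum.shift_bounds_nat_ivl[of F 0 "k * d" d] by (simp add: lessThan_atLeast0 add.commute)
  qed
  also have "\<dots> = (\<Sum>b<d * y. F b)" by (simp add: sum.nat_group mult.commute)
  finally show ?thesis by (simp add: dilated_avg_def F_def)
qed

lemma dilated_avg_compose:
  assumes per: "\<And>w. g (w + 1) = g w" and "0 < d" and "0 < y"
  shows "dilated_avg a d (dilated_avg x y g) z =
    of_nat (gcd d x) * dilated_avg (a * (x div gcd d x)) (d div gcd d x * y) g z"
proof -
  let ?h = "dilated_avg 1 y g" and ?e = "gcd d x"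
  have d': "0 < d div ?e" using \<open>0 < d\<close> by (metis dvd_div_eq_0_iff gcd_dvd1 gr0I less_irrefl)
  have "dilated_avg a d (dilated_avg x y g) z =
      (\<Sum>b<d. ?h (of_nat x * ((of_nat a * z + of_nat b) / of_nat d)))"
    by (simp add: dilated_avg_def)
  also have "\<dots> = of_nat ?e * dilated_avg (x div ?e) (d div ?e) ?h (of_nat a * z)"
    by (rule avg_of_dilation) (rule dilated_avg_periodic per assms(2,3))+
  also have "\<dots> = of_nat ?e * dilated_avg (x div ?e) (d div ?e * y) g (of_nat a * z)"
    by (simp only: dilated_avg_avg[OF d'])
  finally show ?thesis by (simp add: dilated_avg_def mult_ac)
qed

lemma finite_factor_pairs: "0 < n \<Longrightarrow> finite (factor_pairs n)"
  by (rule finite_subset[of _ "{..n} \<times> {..n}"]) (auto simp: factor_pairs_def)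

lemma gcd_cofactors:
  fixes u v :: nat
  assumes "0 < u"
  obtains u' v' where "u = gcd u v * u'" and "v = gcd u v * v'" and "coprime u' v'"
proof (rule that)
  show "coprime (u div gcd u v) (v div gcd u v)"
    using assms by (intro div_gcd_coprime) auto
qed auto

text \<open>With \<open>d / x'\<close> the lowest terms of \<open>m / x\<close>, the equation becomes \<open>x' y = d n\<close>, and coprimality
  forces \<open>x'\<close> to divide \<open>n\<close>. The quotient is the common cofactor of \<open>n\<close> and \<open>y\<close>.\<close>

lemma four_number_split:
  fixes m n x y :: nat
  assumes "0 < m" and eq: "x * y = m * n"
  obtains d x' y' where "m = gcd m x * d" and "x = gcd m x * x'"
    and "n = x' * y'" and "y = d * y'" and "coprime d x'"
proof -
  define g where "g = gcd m x"
  obtain d x' where d: "m = g * d" and x: "x = g * x'" and cop: "coprime d x'"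
    using gcd_cofactors[OF assms(1), of x] unfolding g_def .
  have pos: "0 < g" using assms(1) by (simp add: g_def)
  have "g * (x' * y) = g * (d * n)" using eq by (simp only: d x mult.assoc)
  with pos have eq': "x' * y = d * n" by simp
  then have "x' dvd d * n" by (metis dvd_triv_left)
  then have "x' dvd n" using cop by (simp add: coprime_dvd_mult_right_iff coprime_commute)
  then obtain y' where n: "n = x' * y'" by (rule dvdE)
  note that = that[folded g_def, OF d x]
  show ?thesis
  proof (cases "x' = 0")
    case True
    \<comment> \<open>Then \<open>x = n = 0\<close> and \<open>d = 1\<close>, and \<open>y\<close> itself is the remaining factor.\<close>
    with cop have "d = 1" by simp
    with True n that[of y] cop show ?thesis by simp
  next
    case False
    have "x' * y = x' * (d * y')" using eq' by (simp only: n mult.left_commute)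
    with False have "y = d * y'" by simp
    with that[OF n] cop show ?thesis by blast
  qed
qed

text \<open>Unique factorisation behind the Hecke relations. Dividing out \<open>e = gcd d x\<close> from
  \<open>m = a d\<close> and \<open>n = x y\<close> leaves \<open>m' = a d'\<close> and \<open>n' = x' y\<close> with \<open>d'\<close>, \<open>x'\<close> coprime.
  Both factorisations can be recovered from \<open>e\<close> and the product \<open>a x'\<close>, because coprimality gives
  \<open>a = gcd m' (a x')\<close>. Conversely \<open>four_number_split\<close> yields such a decomposition from any
  factorisation of \<open>m' n'\<close> into two factors.\<close>

lemma sum_factor_pairs_reindex:
  fixes G :: "nat \<Rightarrow> nat \<Rightarrow> nat \<Rightarrow> complex"
  assumes "0 < m" and "0 < n"
  shows "(\<Sum>((a, d), (x, y))\<in>factor_pairs m \<times> factor_pairs n.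
            G (gcd d x) (a * (x div gcd d x)) (d div gcd d x * y)) =
         (\<Sum>(e, (x, y))\<in>(SIGMA e:{e. e dvd gcd m n}. factor_pairs (m * n div e\<^sup>2)). G e x y)"
proof (rule sum.reindex_bij_witness[where
    i = "\<lambda>(e, (x, y)). let a = gcd (m div e) x in
           ((a, m div a), (e * (x div a), n div (e * (x div a))))" and
    j = "\<lambda>((a, d), (x, y)). (gcd d x, (a * (x div gcd d x), d div gcd d x * y))"], goal_cases)
  case (1 p)
  then obtain a d x y where p: "p = ((a, d), (x, y))" and m: "m = a * d" and n: "n = x * y"
    by (auto simp: factor_pairs_def)
  define e where "e = gcd d x"
  have pos: "0 < a" "0 < d" "0 < x" "0 < y" using assms by (auto simp: m n)
  obtain d' x' where d: "d = e * d'" and x: "x = e * x'" and cop: "coprime d' x'"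
    using gcd_cofactors[OF pos(2), of x] unfolding e_def by blast
  have e: "0 < e" using pos by (simp add: e_def)
  have "gcd (m div e) (a * x') = a"
    using e cop by (simp add: m d gcd_mult_distrib_nat[symmetric] mult.left_commute[of a e])
  moreover have "gcd d x = e" by (simp add: e_def)
  ultimately show ?case using pos e by (simp add: p m n d x Let_def)
next
  case (2 p)
  then obtain a d x y where p: "p = ((a, d), (x, y))" and m: "m = a * d" and n: "n = x * y"
    by (auto simp: factor_pairs_def)
  define e where "e = gcd d x"
  have pos: "0 < a" "0 < d" "0 < x" "0 < y" using assms by (auto simp: m n)
  obtain d' x' where d: "d = e * d'" and x: "x = e * x'"
    using gcd_cofactors[OF pos(2), of x] unfolding e_def by blast
  have e: "0 < e" using pos by (simp add: e_def)
  have mn: "m * n = a * x' * (d' * y) * e\<^sup>2" by (simp add: m n d x power2_eq_square)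
  have "gcd d x = e" by (simp add: e_def)
  moreover have "e dvd m" "e dvd n" by (auto simp: m n d x)
  moreover have "m * n div e\<^sup>2 = a * x' * (d' * y)" using e by (simp add: mn)
  ultimately show ?case using e by (simp add: p d x factor_pairs_def)
next
  case (3 q)
  then obtain e x y where q: "q = (e, (x, y))" and dvd: "e dvd m" "e dvd n"
    and xy: "x * y = m * n div e\<^sup>2"
    by (auto simp: factor_pairs_def)
  obtain m' where m: "m = e * m'" using dvd(1) by (rule dvdE)
  obtain n' where n: "n = e * n'" using dvd(2) by (rule dvdE)
  have e: "0 < e" and pos: "0 < m'" "0 < n'" using assms by (auto simp: m n)
  have xy: "x * y = m' * n'" using xy e by (simp add: m n power2_eq_square)
  obtain d' x' y' where d': "m' = gcd m' x * d'" and x: "x = gcd m' x * x'"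
    and n': "n' = x' * y'" and y: "y = d' * y'" and cop: "coprime d' x'"
    using four_number_split[OF pos(1) xy] .
  define a where "a = gcd m' x"
  have d': "m' = a * d'" and x: "x = a * x'" using d' x by (simp_all add: a_def)
  have a: "0 < a" using pos by (simp add: a_def)
  have x': "0 < x'" using pos n' by auto
  have "gcd (e * d') (e * x') = e" using cop by (simp add: gcd_mult_distrib_nat[symmetric])
  moreover have "gcd (m div e) x = a" using e by (simp add: m a_def)
  moreover have "m div a = e * d'" using a by (simp add: m d')
  moreover have "x div a = x'" using a by (simp add: x)
  moreover have "n div (e * x') = y'" using e x' by (simp add: n n')
  ultimately show ?case using e by (simp add: q Let_def x y)
next
  case (4 q)
  then obtain e x y where q: "q = (e, (x, y))" and dvd: "e dvd m" "e dvd n"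
    and xy: "x * y = m * n div e\<^sup>2"
    by (auto simp: factor_pairs_def)
  obtain m' where m: "m = e * m'" using dvd(1) by (rule dvdE)
  obtain n' where n: "n = e * n'" using dvd(2) by (rule dvdE)
  have e: "0 < e" and pos: "0 < m'" "0 < n'" using assms by (auto simp: m n)
  have xy: "x * y = m' * n'" using xy e by (simp add: m n power2_eq_square)
  obtain d' x' y' where d': "m' = gcd m' x * d'" and x: "x = gcd m' x * x'"
    and n': "n' = x' * y'" and y: "y = d' * y'" and cop: "coprime d' x'"
    using four_number_split[OF pos(1) xy] .
  define a where "a = gcd m' x"
  have d': "m' = a * d'" and x: "x = a * x'" using d' x by (simp_all add: a_def)
  have a: "0 < a" using pos by (simp add: a_def)
  have "e * x' dvd n" by (simp add: n n')
  moreover have "gcd (m div e) x = a" using e by (simp add: m a_def)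
  moreover have "a dvd m" by (simp add: m d')
  moreover have "x div a = x'" using a by (simp add: x)
  ultimately show ?case by (simp add: q Let_def factor_pairs_def)
next
  case (5 p)
  then show ?case by auto
qed

lemma dilated_avg_sum:
  "dilated_avg a d (\<lambda>w. \<Sum>p\<in>A. h p w) z = (\<Sum>p\<in>A. dilated_avg a d (h p) z)"
  unfolding dilated_avg_def by (rule sum.swap)

lemma hecke_sum_compose:
  assumes per: "\<And>w. g (w + 1) = g w" and "0 < m" and "0 < n"
  shows "hecke_sum m (hecke_sum n g) z =
    (\<Sum>e | e dvd gcd m n. of_nat e * hecke_sum (m * n div e\<^sup>2) g z)"
proof -
  have "hecke_sum m (hecke_sum n g) z = (\<Sum>(a, d)\<in>factor_pairs m. \<Sum>(x, y)\<in>factor_pairs n.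
      dilated_avg a d (dilated_avg x y g) z)"
    by (simp only: hecke_sum_def [abs_def] split_def dilated_avg_sum)
  also have "\<dots> = (\<Sum>(a, d)\<in>factor_pairs m. \<Sum>(x, y)\<in>factor_pairs n.
      of_nat (gcd d x) * dilated_avg (a * (x div gcd d x)) (d div gcd d x * y) g z)"
  proof -
    have "dilated_avg a d (dilated_avg x y g) z =
      of_nat (gcd d x) * dilated_avg (a * (x div gcd d x)) (d div gcd d x * y) g z"
      if "(a, d) \<in> factor_pairs m" "(x, y) \<in> factor_pairs n" for a d x y
      using that assms by (intro dilated_avg_compose) (auto simp: factor_pairs_def)
    then show ?thesis by (intro sum.cong refl) (auto intro!: sum.cong)
  qed
  also have "\<dots> = (\<Sum>((a, d), (x, y))\<in>factor_pairs m \<times> factor_pairs n.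
      of_nat (gcd d x) * dilated_avg (a * (x div gcd d x)) (d div gcd d x * y) g z)"
    by (simp add: sum.cartesian_product split_def)
  also have "\<dots> = (\<Sum>(e, (x, y))\<in>(SIGMA e:{e. e dvd gcd m n}. factor_pairs (m * n div e\<^sup>2)).
      of_nat e * dilated_avg x y g z)"
    using sum_factor_pairs_reindex[OF assms(2,3), of "\<lambda>e x y. of_nat e * dilated_avg x y g z"] .
  also have "\<dots> = (\<Sum>e | e dvd gcd m n. \<Sum>(x, y)\<in>factor_pairs (m * n div e\<^sup>2).
      of_nat e * dilated_avg x y g z)"
  proof (rule sum.Sigma[symmetric])
    show "finite {e. e dvd gcd m n}" using assms by simp
    show "\<forall>e\<in>{e. e dvd gcd m n}. finite (factor_pairs (m * n div e\<^sup>2))"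
    proof
      fix e assume "e \<in> {e. e dvd gcd m n}"
      then have "e\<^sup>2 dvd m * n" by (simp add: power2_eq_square mult_dvd_mono)
      then have "0 < m * n div e\<^sup>2" using assms by (metis dvd_div_eq_0_iff mult_pos_pos not_gr0)
      then show "finite (factor_pairs (m * n div e\<^sup>2))" by (rule finite_factor_pairs)
    qed
  qed
  finally show ?thesis by (simp add: hecke_sum_def sum_distrib_left split_def)
qed

lemma hecke_sum_scale: "hecke_sum n (\<lambda>z. k * g z) z = k * hecke_sum n g z"
  by (simp add: hecke_sum_def dilated_avg_def sum_distrib_left split_def)

lemma hecke_eq_hecke_sum:
  assumes "0 < n" and "coprime n N"
  shows "hecke N n g z = hecke_sum n g z / of_real (sqrt (real n))"
proof -
  have "{(a, d). a * d = n \<and> 0 < d \<and> coprime a N} = factor_pairs n"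
    using assms by (auto simp: factor_pairs_def)
  then show ?thesis by (simp add: hecke_def hecke_sum_def dilated_avg_def)
qed

text \<open>The powers of \<open>e\<close> disappear here because \<open>e \<surd>(m n / e\<^sup>2) = \<surd>m \<surd>n\<close>. A point at which
  \<open>g\<close> does not vanish turns the operator identity into one between eigenvalues.\<close>

lemma hecke_eigenvalue_mult:
  assumes per: "\<And>w. g (w + 1) = g w" and nz: "g z0 \<noteq> 0"
    and eig: "\<And>k. 0 < k \<Longrightarrow> hecke N k g = fun_scale (of_real (ev k)) g"
    and m: "0 < m" "coprime m N" and n: "0 < n" "coprime n N"
  shows "ev m * ev n = (\<Sum>e | e dvd gcd m n. ev (m * n div e\<^sup>2))"
proof -
  have S: "hecke_sum k g = (\<lambda>z. of_real (sqrt (real k) * ev k) * g z)"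
    if "0 < k" "coprime k N" for k
  proof
    fix z
    have "hecke_sum k g z / of_real (sqrt (real k)) = of_real (ev k) * g z"
      using fun_cong[OF eig[OF that(1)], of z] by (simp add: hecke_eq_hecke_sum[OF that] fun_scale_def)
    with that(1) show "hecke_sum k g z = of_real (sqrt (real k) * ev k) * g z"
      by (simp add: nonzero_divide_eq_eq mult_ac)
  qed
  have "of_real (sqrt (real m) * ev m * (sqrt (real n) * ev n)) * g z0 = hecke_sum m (hecke_sum n g) z0"
    unfolding S[OF n] hecke_sum_scale by (simp add: S[OF m])
  also have "\<dots> = (\<Sum>e | e dvd gcd m n. of_nat e * hecke_sum (m * n div e\<^sup>2) g z0)"
    by (rule hecke_sum_compose) (use per m n in auto)
  also have "\<dots> = (\<Sum>e | e dvd gcd m n.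
      of_real (sqrt (real m) * sqrt (real n) * ev (m * n div e\<^sup>2)) * g z0)"
  proof (rule sum.cong[OF refl])
    fix e assume "e \<in> {e. e dvd gcd m n}"
    then obtain m' n' where m': "m = e * m'" and n': "n = e * n'" by (auto elim!: dvdE)
    have pos: "0 < e" "0 < m'" "0 < n'" using m n by (auto simp: m' n')
    have q: "m * n div e\<^sup>2 = m' * n'" using pos by (simp add: m' n' power2_eq_square)
    have "coprime (m' * n') N" using m n by (simp add: m' n')
    then have "of_nat e * hecke_sum (m' * n') g z0 =
        of_real (real e * sqrt (real (m' * n')) * ev (m' * n')) * g z0"
      using pos by (simp add: S)
    moreover have "real e * sqrt (real (m' * n')) = sqrt (real m) * sqrt (real n)"
      by (simp add: m' n' real_sqrt_mult)
    ultimately show "of_nat e * hecke_sum (m * n div e\<^sup>2) g z0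
      = of_real (sqrt (real m) * sqrt (real n) * ev (m * n div e\<^sup>2)) * g z0"
      by (simp only: q)
  qed
  also have "\<dots> = of_real (sqrt (real m) * sqrt (real n) *
      (\<Sum>e | e dvd gcd m n. ev (m * n div e\<^sup>2))) * g z0"
    by (simp add: sum_distrib_left sum_distrib_right)
  finally have "sqrt (real m) * ev m * (sqrt (real n) * ev n) =
      sqrt (real m) * sqrt (real n) * (\<Sum>e | e dvd gcd m n. ev (m * n div e\<^sup>2))"
    using nz by (simp only: mult_cancel_right of_real_eq_iff) simp
  then show ?thesis using m n by (simp add: mult.assoc mult.left_commute[of "ev m"])
qed

text \<open>Below and on the real axis both sides are zero by the extension convention, so periodicity holds
  on all of \<open>\<complex>\<close>.\<close>

lemma maass_cusp_form_periodic:
  assumes "maass_cusp_form N l f"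
  shows "f (z + 1) = f z"
proof (cases "z \<in> upper_half_plane")
  case True
  have "Gamma0_invariant N f" using assms by (simp add: maass_cusp_form_def)
  then have "f (moebius_act 1 1 0 1 z) = f z"
    using True unfolding Gamma0_invariant_def by (metis diff_zero dvd_0_right mult_1 mult_zero_right)
  then show ?thesis by (simp add: moebius_act_def)
next
  case False
  then have "z + 1 \<notin> upper_half_plane" by (simp add: upper_half_plane_def)
  with False assms show ?thesis by (simp add: maass_cusp_form_def)
qed

lemma maass_cusp_form_nonzero:
  assumes "maass_cusp_form N l f"
  shows "\<exists>z. f z \<noteq> 0"
  using assms unfolding maass_cusp_form_def constant_on_def by metis

lemma newform_eigenbasis_hecke_relation:
  assumes basis: "newform_eigenbasis N f ev a"
    and "0 < m" "coprime m N" "0 < n" "coprime n N"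
  shows "a j m * a j n = (\<Sum>e | e dvd gcd m n. a j (m * n div e\<^sup>2))"
proof -
  have cusp: "maass_cusp_form N (ev j) (f j)"
    and eig: "\<And>k. 0 < k \<Longrightarrow> hecke N k (f j) = fun_scale (of_real (a j k)) (f j)"
    using basis by (auto simp: newform_eigenbasis_def)
  obtain z where "f j z \<noteq> 0" using maass_cusp_form_nonzero[OF cusp] by blast
  then show ?thesis
    using hecke_eigenvalue_mult[where N = N, OF maass_cusp_form_periodic[OF cusp] _ eig] assms by blast
qed

section \<open>Spectral sums\<close>

lemma suminf_Cauchy_Schwarz:
  fixes x y :: "nat \<Rightarrow> real"
  assumes "summable (\<lambda>j. (x j)\<^sup>2)" and "summable (\<lambda>j. (y j)\<^sup>2)" and "(\<lambda>j. x j * y j) sums s"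
  shows "\<bar>s\<bar> \<le> sqrt (\<Sum>j. (x j)\<^sup>2) * sqrt (\<Sum>j. (y j)\<^sup>2)"
proof (rule LIMSEQ_le_const2)
  show "(\<lambda>k. \<bar>\<Sum>j<k. x j * y j\<bar>) \<longlonglongrightarrow> \<bar>s\<bar>"
    using assms(3) by (intro tendsto_rabs) (simp add: sums_def)
  have "\<bar>\<Sum>j<k. x j * y j\<bar> \<le> sqrt (\<Sum>j. (x j)\<^sup>2) * sqrt (\<Sum>j. (y j)\<^sup>2)" for k
  proof -
    have "\<bar>\<Sum>j<k. x j * y j\<bar> \<le> (\<Sum>j<k. \<bar>x j\<bar> * \<bar>y j\<bar>)"
      by (rule order_trans[OF sum_abs]) (simp add: abs_mult)
    also have "\<dots> \<le> L2_set x {..<k} * L2_set y {..<k}" by (rule L2_set_mult_ineq)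
    also have "\<dots> \<le> sqrt (\<Sum>j. (x j)\<^sup>2) * sqrt (\<Sum>j. (y j)\<^sup>2)"
      unfolding L2_set_def
      by (intro mult_mono real_sqrt_le_mono sum_le_suminf assms real_sqrt_ge_zero sum_nonneg suminf_nonneg)
        auto
    finally show ?thesis .
  qed
  then show "\<exists>K. \<forall>k\<ge>K. \<bar>\<Sum>j<k. x j * y j\<bar> \<le> sqrt (\<Sum>j. (x j)\<^sup>2) * sqrt (\<Sum>j. (y j)\<^sup>2)" by blast
qed

lemma spectral_sum_product:
  assumes basis: "newform_eigenbasis N f ev a"
    and trace: "\<And>n. \<lbrakk>0 < n; coprime n N\<rbrakk> \<Longrightarrow> (\<lambda>j. a j n * F (ev j)) sums T n"
    and m: "0 < m" "coprime m N" and n: "0 < n" "coprime n N"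
  shows "(\<lambda>j. a j m * a j n * F (ev j)) sums (\<Sum>e | e dvd gcd m n. T (m * n div e\<^sup>2))"
proof -
  have "(\<lambda>j. \<Sum>e | e dvd gcd m n. a j (m * n div e\<^sup>2) * F (ev j)) sums
      (\<Sum>e | e dvd gcd m n. T (m * n div e\<^sup>2))"
  proof (rule sums_sum)
    fix e assume "e \<in> {e. e dvd gcd m n}"
    then obtain m' n' where m': "m = e * m'" and n': "n = e * n'" by (auto elim!: dvdE)
    have pos: "0 < e" "0 < m'" "0 < n'" using m n by (auto simp: m' n')
    have "m * n div e\<^sup>2 = m' * n'" using pos by (simp add: m' n' power2_eq_square)
    moreover have "coprime (m' * n') N" using m n by (simp add: m' n')
    ultimately show "(\<lambda>j. a j (m * n div e\<^sup>2) * F (ev j)) sums T (m * n div e\<^sup>2)"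
      using pos by (simp add: trace)
  qed
  then show ?thesis
    by (simp add: newform_eigenbasis_hecke_relation[OF basis m n] sum_distrib_right)
qed

lemma spectral_sum_lin_form:
  assumes basis: "newform_eigenbasis N f ev a"
    and trace: "\<And>n. \<lbrakk>0 < n; coprime n N\<rbrakk> \<Longrightarrow> (\<lambda>j. a j n * F (ev j)) sums T n"
    and c: "\<And>m. \<not> coprime m N \<Longrightarrow> c m = 0" and n: "0 < n" "coprime n N"
  shows "(\<lambda>j. lin_form a M c j * a j n * F (ev j)) sums
    (\<Sum>m=1..M. c m * (\<Sum>e | e dvd gcd m n. T (m * n div e\<^sup>2)))"
proof -
  have "(\<lambda>j. \<Sum>m=1..M. c m * (a j m * a j n * F (ev j))) sums
    (\<Sum>m=1..M. c m * (\<Sum>e | e dvd gcd m n. T (m * n div e\<^sup>2)))"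
  proof (rule sums_sum)
    fix m assume m: "m \<in> {1..M}"
    show "(\<lambda>j. c m * (a j m * a j n * F (ev j))) sums
        (c m * (\<Sum>e | e dvd gcd m n. T (m * n div e\<^sup>2)))"
    proof (cases "coprime m N")
      case True
      then show ?thesis using m n by (intro sums_mult spectral_sum_product[OF basis trace]) auto
    qed (simp add: c)
  qed
  then show ?thesis by (simp add: lin_form_def sum_distrib_right mult.assoc)
qed

text \<open>Expanding one of the two linear forms writes its
  series as a finite combination of series whose convergence is part of \<open>spectral_sum_lin_form\<close>.\<close>

lemma summable_quad_form:
  assumes basis: "newform_eigenbasis N f ev a"
    and trace: "\<And>n. \<lbrakk>0 < n; coprime n N\<rbrakk> \<Longrightarrow> (\<lambda>j. a j n * F (ev j)) sums T n"
    and c: "\<And>m. \<not> coprime m N \<Longrightarrow> c m = 0"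
  shows "summable (\<lambda>j. (lin_form a M c j)\<^sup>2 * F (ev j))"
proof -
  have "summable (\<lambda>j. \<Sum>m=1..M. c m * (lin_form a M c j * a j m * F (ev j)))"
  proof (rule summable_sum)
    fix m assume m: "m \<in> {1..M}"
    show "summable (\<lambda>j. c m * (lin_form a M c j * a j m * F (ev j)))"
    proof (cases "coprime m N")
      case True
      then show ?thesis
        using m by (intro summable_mult sums_summable[OF spectral_sum_lin_form[OF basis trace c]]) auto
    qed (simp add: c)
  qed
  moreover have "(lin_form a M c j)\<^sup>2 * F (ev j) =
      (\<Sum>m=1..M. c m * (lin_form a M c j * a j m * F (ev j)))" for j
  proof -
    have "(lin_form a M c j)\<^sup>2 * F (ev j) = (\<Sum>m=1..M. c m * a j m) * (lin_form a M c j * F (ev j))"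
      by (simp add: power2_eq_square lin_form_def)
    also have "\<dots> = (\<Sum>m=1..M. c m * (lin_form a M c j * a j m * F (ev j)))"
      unfolding sum_distrib_right by (intro sum.cong refl) (simp only: mult_ac)
    finally show ?thesis .
  qed
  ultimately show ?thesis by simp
qed

lemma lin_form_unit_seq: "0 < n \<Longrightarrow> lin_form a n (unit_seq n) j = a j n"
  by (simp add: lin_form_def unit_seq_def if_distrib[of "\<lambda>x. x * _"] cong: if_cong)


theorem mainTheorem3:
  fixes N M i :: nat
    and f :: "nat \<Rightarrow> complex \<Rightarrow> complex"
    and ev :: "nat \<Rightarrow> real"
    and a :: "nat \<Rightarrow> nat \<Rightarrow> real"
    and H Ht Hi :: "real \<Rightarrow> real"
    and t :: "nat \<Rightarrow> (real \<Rightarrow> real) \<Rightarrow> real"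
    and I :: "nat set"
    and Qm Qt P :: "nat \<Rightarrow> nat \<Rightarrow> real"
    and D c :: "nat \<Rightarrow> real"
    and evt \<epsilon> \<delta> W :: real
    and \<eta> :: "nat \<Rightarrow> real"
  assumes "0 < N" and "squarefree N"
    and "newform_eigenbasis N f ev a" and "incseq ev"
    and "\<And>x. 0 < x \<Longrightarrow> 0 \<le> H x"
    and "Ht = (\<lambda>x. x * H x)"
    and "Hi = (\<lambda>x. H x * (x - evt)\<^sup>2)"
    and "selberg_test_function H" and "selberg_test_function Ht" and "selberg_test_function Hi"
    and "\<And>n F. \<lbrakk>0 < n; coprime n N; F \<in> {H, Ht, Hi}\<rbrakk> \<Longrightarrow> (\<lambda>j. a j n * F (ev j)) sums t n F"
    and "1 \<le> M" and "I = {m \<in> {1..M}. coprime m N}"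
    and "quad_form_matrix I (\<lambda>c. quad_form a ev M c H) Qm"
    and "quad_form_matrix I (\<lambda>c. quad_form a ev M c Ht) Qt"
    and "orthogonal_on I P" and "\<forall>k\<in>I. 0 < D k"
    and "\<forall>m\<in>I. \<forall>m'\<in>I. Qm m m' = (\<Sum>k\<in>I. P m k * D k * P m' k)"
    and "\<forall>m. m \<notin> I \<longrightarrow> c m = 0" and "\<exists>m\<in>I. c m \<noteq> 0"
    and "\<forall>m\<in>I. (\<Sum>m'\<in>I. Qt m m' * c m') = evt * (\<Sum>m'\<in>I. Qm m m' * c m')"
    and "\<epsilon> = sqrt (quad_form a ev M c Hi / quad_form a ev M c H)"
    and "0 < \<delta>"
    and "\<bar>ev i - evt\<bar> \<le> \<epsilon>" and "\<forall>j. j \<noteq> i \<longrightarrow> \<delta> \<le> \<bar>ev j - evt\<bar>"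
    and "W = lin_form a M c i * H (ev i)"
    and "\<forall>n. \<eta> n = \<epsilon> / \<delta> * sqrt (quad_form a ev M c H * quad_form a ev n (unit_seq n) H)"
  shows "\<forall>n. 0 < n \<and> coprime n N \<longrightarrow>
           (\<exists>\<beta>::real. \<bar>\<beta>\<bar> \<le> 1 \<and>
              a i n * W = (\<Sum>m=1..M. c m * (\<Sum>d | d dvd gcd m n. t (m * n div d\<^sup>2) H)) + \<beta> * \<eta> n)"
proof (intro allI impI, elim conjE)
  fix n assume n: "0 < n" "coprime n N"
  note basis = assms(3) and trace = assms(11) and c0 = assms(19)
  have c: "c m = 0" if "\<not> coprime m N" for m using that c0 by (simp add: assms(13))
  have ev: "0 < ev j" for j using basis by (simp add: newform_eigenbasis_def)
  have Hev: "0 \<le> H (ev j)" for j by (rule assms(5)[OF ev])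
  let ?L = "lin_form a M c"
  let ?S = "\<Sum>m=1..M. c m * (\<Sum>d | d dvd gcd m n. t (m * n div d\<^sup>2) H)"
  have sumH: "summable (\<lambda>j. (?L j)\<^sup>2 * H (ev j))"
    by (rule summable_quad_form[OF basis, where T = "\<lambda>n. t n H"]) (auto intro: trace c)
  have sumHi: "summable (\<lambda>j. (?L j)\<^sup>2 * Hi (ev j))"
    by (rule summable_quad_form[OF basis, where T = "\<lambda>n. t n Hi"]) (auto intro: trace c)
  have sumE: "(\<lambda>j. a j n * a j n * H (ev j)) sums (\<Sum>e | e dvd gcd n n. t (n * n div e\<^sup>2) H)"
    by (rule spectral_sum_product[OF basis _ n n]) (auto intro: trace)
  have sumS: "(\<lambda>j. ?L j * a j n * H (ev j)) sums ?S"
    by (rule spectral_sum_lin_form[OF basis _ _ n]) (auto intro: trace c)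
  \<comment> \<open>Both factors carry \<open>\<surd>H\<close>, so that their squares are summands of quadratic forms in \<open>H\<close>.\<close>
  define x where "x j = (if j = i then 0 else ?L j * sqrt (H (ev j)))" for j
  define y where "y j = a j n * sqrt (H (ev j))" for j
  have y2: "(y j)\<^sup>2 = (lin_form a n (unit_seq n) j)\<^sup>2 * H (ev j)" for j
    using n Hev[of j] by (simp add: y_def power_mult_distrib lin_form_unit_seq)
  have sumy: "summable (\<lambda>j. (y j)\<^sup>2)"
  proof -
    have "(y j)\<^sup>2 = a j n * a j n * H (ev j)" for j
      unfolding y2 lin_form_unit_seq[OF n(1)] by (simp only: power2_eq_square)
    then show ?thesis using sums_summable[OF sumE] by presburger
  qed
  have x2: "(x j)\<^sup>2 \<le> 1 / \<delta>\<^sup>2 * ((?L j)\<^sup>2 * Hi (ev j))" for j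
  proof (cases "j = i")
    case True
    then show ?thesis using Hev[of j] by (simp add: x_def assms(7))
  next
    case False
    then have "\<delta>\<^sup>2 \<le> (ev j - evt)\<^sup>2"
      using assms(23,25) by (metis abs_of_pos abs_le_square_iff)
    then have "(?L j)\<^sup>2 * H (ev j) * \<delta>\<^sup>2 \<le> (?L j)\<^sup>2 * H (ev j) * (ev j - evt)\<^sup>2"
      using Hev[of j] by (intro mult_left_mono) auto
    then show ?thesis
      using False Hev[of j] assms(23)
      by (simp add: x_def assms(7) power_mult_distrib field_simps)
  qed
  have sumx: "summable (\<lambda>j. (x j)\<^sup>2)"
    by (rule summable_comparison_test'[where N = 0, OF summable_mult[OF sumHi, of "1 / \<delta>\<^sup>2"]])
      (simp only: real_norm_def abs_power2 x2)
  have "(\<lambda>j. ?L j * a j n * H (ev j) - (if j = i then ?L j * a j n * H (ev j) else 0)) sums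
      (?S - ?L i * a i n * H (ev i))"
    by (intro sums_diff sumS sums_single)
  moreover have "?L j * a j n * H (ev j) - (if j = i then ?L j * a j n * H (ev j) else 0) = x j * y j" for j
    using Hev[of j] by (simp add: x_def y_def)
  ultimately have sumxy: "(\<lambda>j. x j * y j) sums (?S - a i n * W)"
    by (simp add: assms(26) mult_ac)
  have QHi: "quad_form a ev M c Hi = \<epsilon>\<^sup>2 * quad_form a ev M c H"
    and QH0: "0 \<le> quad_form a ev M c H" and eps0: "0 \<le> \<epsilon>"
  proof -
    have Hi0: "0 \<le> (?L j)\<^sup>2 * Hi (ev j)" for j using Hev[of j] by (simp add: assms(7))
    have Q1: "0 \<le> quad_form a ev M c Hi"
      unfolding quad_form_def by (rule suminf_nonneg[OF sumHi Hi0])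
    show Q0: "0 \<le> quad_form a ev M c H"
      unfolding quad_form_def by (rule suminf_nonneg[OF sumH]) (simp add: Hev)
    show "0 \<le> \<epsilon>" using Q0 Q1 by (simp add: assms(22))
    show "quad_form a ev M c Hi = \<epsilon>\<^sup>2 * quad_form a ev M c H"
      \<comment> \<open>If the denominator of \<open>\<epsilon>\<close> is zero, then \<open>\<epsilon> = 0\<close> by convention and every term
        of both forms is zero.\<close>
    proof (cases "quad_form a ev M c H = 0")
      case True
      then have "\<forall>j. (?L j)\<^sup>2 * H (ev j) = 0"
        using suminf_eq_zero_iff[OF sumH] Hev by (simp add: quad_form_def)
      then have "(?L j)\<^sup>2 * Hi (ev j) = 0" for j by (auto simp: assms(7))
      then have "quad_form a ev M c Hi = 0" by (simp only: quad_form_def suminf_zero)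
      with True show ?thesis by simp
    next
      case False
      then show ?thesis using Q0 Q1 by (simp add: assms(22))
    qed
  qed
  have "(\<Sum>j. (x j)\<^sup>2) \<le> (\<Sum>j. 1 / \<delta>\<^sup>2 * ((?L j)\<^sup>2 * Hi (ev j)))"
    by (intro suminf_le x2 sumx summable_mult sumHi)
  also have "\<dots> = 1 / \<delta>\<^sup>2 * quad_form a ev M c Hi"
    unfolding quad_form_def by (rule suminf_mult[OF sumHi])
  also have "\<dots> = (\<epsilon> / \<delta>)\<^sup>2 * quad_form a ev M c H" by (simp add: QHi power_divide)
  finally have "sqrt (\<Sum>j. (x j)\<^sup>2) \<le> sqrt ((\<epsilon> / \<delta>)\<^sup>2 * quad_form a ev M c H)"
    by (rule real_sqrt_le_mono)
  then have X: "sqrt (\<Sum>j. (x j)\<^sup>2) \<le> \<epsilon> / \<delta> * sqrt (quad_form a ev M c H)"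
    using eps0 assms(23) by (simp add: real_sqrt_mult)
  have Y: "(\<Sum>j. (y j)\<^sup>2) = quad_form a ev n (unit_seq n) H"
    by (simp add: y2 quad_form_def)
  have "\<bar>?S - a i n * W\<bar> \<le> sqrt (\<Sum>j. (x j)\<^sup>2) * sqrt (\<Sum>j. (y j)\<^sup>2)"
    by (rule suminf_Cauchy_Schwarz[OF sumx sumy sumxy])
  also have "\<dots> \<le> \<epsilon> / \<delta> * sqrt (quad_form a ev M c H) * sqrt (\<Sum>j. (y j)\<^sup>2)"
    by (intro mult_right_mono X real_sqrt_ge_zero suminf_nonneg sumy) auto
  also have "\<dots> = \<eta> n" by (simp add: Y assms(27) real_sqrt_mult)
  finally have bound: "\<bar>a i n * W - ?S\<bar> \<le> \<eta> n" by (simp add: abs_minus_commute)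
  show "\<exists>\<beta>. \<bar>\<beta>\<bar> \<le> 1 \<and> a i n * W = ?S + \<beta> * \<eta> n"
    \<comment> \<open>If \<open>\<eta> n = 0\<close>, this witness is \<open>0\<close> by the convention for division, and the bound makes
      the two main terms equal.\<close>
  proof (intro exI conjI)
    show "\<bar>(a i n * W - ?S) / \<eta> n\<bar> \<le> 1"
      using bound by (auto simp: abs_divide divide_le_eq_1)
    show "a i n * W = ?S + (a i n * W - ?S) / \<eta> n * \<eta> n" using bound by auto
  qed
qed

end
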